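(* Suppose there exist $P_1\in\mathbb S^{n\times n}$, $Y_1\in\mathbb R^{T\times n}$ and $G_2\in\mathbb R^{T\times(S-n)}$ satisfying $$Z_0Y_1=\begin{bmatrix}P_1\\ 0_{(S-n)\times n}\end{bmatrix},\qquad \begin{bmatrix}P_1&(X_1Y_1)^\top\\ X_1Y_1&P_1\end{bmatrix}\succ0,\qquad Z_0G_2=\begin{bmatrix}0_{n\times(S-n)}\\ I_{S-n}\end{bmatrix},\qquad X_1G_2=0_{n\times(S-n)}.$$ Then the control law $u=KZ(x)$ with $$K=U_0\begin{bmatrix}Y_1&G_2\end{bmatrix}\begin{bmatrix}P_1&0_{n\times(S-n)}\\ 0_{(S-n)\times n}&I_{S-n}\end{bmatrix}^{-1}$$ linearizes the closed-loop dynamics (i.e. there is a matrix $M\in\mathbb R^{n\times n}$ such that $AZ(x)+BKZ(x)=Mx$ for all $x\in\mathbb R^n$) and renders the origin a globally asymptotically stable equilibrium of the closed-loop system.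
   Context: Let $n,m,S,T$ be positive integers with $S\ge n$ (blocks of zero size are absent when $S=n$). Consider the discrete-time system $x^+=AZ(x)+Bu$, i.e. $x(t+1)=AZ(x(t))+Bu(t)$, with $x\in\mathbb R^n$, $u\in\mathbb R^m$, constant matrices $A\in\mathbb R^{n\times S}$, $B\in\mathbb R^{n\times m}$ (unknown to the designer), and $Z(x)=\begin{bmatrix}x\\ Q(x)\end{bmatrix}$ with a known function $Q:\mathbb R^n\to\mathbb R^{S-n}$. Data: samples $x(0),\dots,x(T)\in\mathbb R^n$, $u(0),\dots,u(T-1)\in\mathbb R^m$ satisfying $x(k+1)=AZ(x(k))+Bu(k)$ for $k=0,\dots,T-1$. Define $U_0=[u(0)\ \cdots\ u(T-1)]\in\mathbb R^{m\times T}$, $X_1=[x(1)\ \cdots\ x(T)]\in\mathbb R^{n\times T}$, $Z_0=[Z(x(0))\ \cdots\ Z(x(T-1))]\in\mathbb R^{S\times T}$. $\mathbb S^{n\times n}$ is the set of real symmetric $n\times n$ matrices; $\succ0$ means positive definite. *)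

theory Defs
  imports Complex_Main "HOL-Library.FuncSet" "Jordan_Normal_Form.Gauss_Jordan_Elimination"
begin

text \<open>Matrices with explicit carriers are used so that blocks with zero rows or columns
  (the case \<open>S = n\<close>) are covered.\<close>

definition vec_norm2 :: "real vec \<Rightarrow> real" where
  "vec_norm2 v = sqrt (v \<bullet> v)"

definition sym_mats :: "nat \<Rightarrow> real mat set" where
  "sym_mats n = {P \<in> carrier_mat n n. transpose_mat P = P}"

definition pos_def :: "real mat \<Rightarrow> bool" where
  "pos_def P \<longleftrightarrow> P \<in> sym_mats (dim_row P) \<and>
     (\<forall>v \<in> carrier_vec (dim_row P). v \<noteq> 0\<^sub>v (dim_row P) \<longrightarrow> v \<bullet> (P *\<^sub>v v) > 0)"

definition append_cols :: "real mat \<Rightarrow> real mat \<Rightarrow> real mat" (infixr \<open>@\<^sub>c\<close> 65) where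
  "A @\<^sub>c B = four_block_mat A B (0\<^sub>m 0 (dim_col A)) (0\<^sub>m 0 (dim_col B))"

definition lift_state :: "(real vec \<Rightarrow> real vec) \<Rightarrow> real vec \<Rightarrow> real vec" where
  "lift_state Q x = x @\<^sub>v Q x"

definition plant ::
  "real mat \<Rightarrow> real mat \<Rightarrow> (real vec \<Rightarrow> real vec) \<Rightarrow> real vec \<Rightarrow> real vec \<Rightarrow> real vec" where
  "plant A B Q x u = A *\<^sub>v lift_state Q x + B *\<^sub>v u"

definition closed_loop ::
  "real mat \<Rightarrow> real mat \<Rightarrow> (real vec \<Rightarrow> real vec) \<Rightarrow> real mat \<Rightarrow> real vec \<Rightarrow> real vec" where
  "closed_loop A B Q K x = plant A B Q x (K *\<^sub>v lift_state Q x)"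

definition input_data :: "nat \<Rightarrow> nat \<Rightarrow> (nat \<Rightarrow> real vec) \<Rightarrow> real mat" where
  "input_data m T u = mat_of_cols m (map u [0..<T])"

definition shifted_state_data :: "nat \<Rightarrow> nat \<Rightarrow> (nat \<Rightarrow> real vec) \<Rightarrow> real mat" where
  "shifted_state_data n T x = mat_of_cols n (map x [1..<T + 1])"

definition lifted_data ::
  "nat \<Rightarrow> nat \<Rightarrow> (real vec \<Rightarrow> real vec) \<Rightarrow> (nat \<Rightarrow> real vec) \<Rightarrow> real mat" where
  "lifted_data S T Q x = mat_of_cols S (map (\<lambda>k. lift_state Q (x k)) [0..<T])"

text \<open>\<^const>\<open>mat_inverse\<close> returns \<^const>\<open>None\<close> on singular matrices, so the gain below is
  specified only if the block-diagonal matrix is invertible.\<close>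

definition feedback_gain ::
  "nat \<Rightarrow> nat \<Rightarrow> real mat \<Rightarrow> real mat \<Rightarrow> real mat \<Rightarrow> real mat \<Rightarrow> real mat" where
  "feedback_gain n S U0 Y1 G2 P1 =
     U0 * (Y1 @\<^sub>c G2) *
     the (mat_inverse (four_block_mat P1 (0\<^sub>m n (S - n)) (0\<^sub>m (S - n) n) (1\<^sub>m (S - n))))"

definition linear_dynamics :: "nat \<Rightarrow> (real vec \<Rightarrow> real vec) \<Rightarrow> bool" where
  "linear_dynamics n f \<longleftrightarrow> (\<exists>M \<in> carrier_mat n n. \<forall>x \<in> carrier_vec n. f x = M *\<^sub>v x)"

definition origin_equilibrium :: "nat \<Rightarrow> (real vec \<Rightarrow> real vec) \<Rightarrow> bool" where
  "origin_equilibrium n f \<longleftrightarrow> f (0\<^sub>v n) = 0\<^sub>v n"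

definition origin_lyapunov_stable :: "nat \<Rightarrow> (real vec \<Rightarrow> real vec) \<Rightarrow> bool" where
  "origin_lyapunov_stable n f \<longleftrightarrow>
     (\<forall>\<epsilon>>0. \<exists>\<delta>>0. \<forall>x0 \<in> carrier_vec n.
        vec_norm2 x0 < \<delta> \<longrightarrow> (\<forall>t. vec_norm2 ((f ^^ t) x0) < \<epsilon>))"

definition origin_globally_attractive :: "nat \<Rightarrow> (real vec \<Rightarrow> real vec) \<Rightarrow> bool" where
  "origin_globally_attractive n f \<longleftrightarrow>
     (\<forall>x0 \<in> carrier_vec n. (\<lambda>t. vec_norm2 ((f ^^ t) x0)) \<longlonglongrightarrow> 0)"

definition origin_globally_asymptotically_stable ::
  "nat \<Rightarrow> (real vec \<Rightarrow> real vec) \<Rightarrow> bool" where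
  "origin_globally_asymptotically_stable n f \<longleftrightarrow>
     origin_equilibrium n f \<and> origin_lyapunov_stable n f \<and> origin_globally_attractive n f"

end

theory Submission
  imports Defs "Jordan_Normal_Form.Determinant"
begin

text \<open>The two equations for \<open>Z\<^sub>0\<close> say that \<open>Z(x) = Z\<^sub>0 g\<close> for \<open>g = Y\<^sub>1 P\<^sub>1\<^sup>-\<^sup>1 x + G\<^sub>2 Q(x)\<close>, and then
  \<open>K Z(x) = U\<^sub>0 g\<close>.  As the data satisfy \<open>X\<^sub>1 = A Z\<^sub>0 + B U\<^sub>0\<close>, the closed loop sends \<open>x\<close> to
  \<open>X\<^sub>1 g = M x\<close> with \<open>M = X\<^sub>1 Y\<^sub>1 P\<^sub>1\<^sup>-\<^sup>1\<close>, the nonlinear part being cancelled by \<open>X\<^sub>1 G\<^sub>2 = 0\<close>.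
  A Lyapunov function is \<open>V(x) = x\<^sup>T P\<^sub>1\<^sup>-\<^sup>1 x\<close>: the block matrix evaluated at
  \<open>(P\<^sub>1\<^sup>-\<^sup>1 x, - P\<^sub>1\<^sup>-\<^sup>1 M x)\<close> is \<open>V(x) - V(M x)\<close>.  Positive definite forms are bounded below by a
  multiple of the squared norm, so \<open>V\<close> decreases geometrically.\<close>

section \<open>Euclidean norms and stability from a geometrically decreasing function\<close>

lemma vec_norm2_nonneg: "0 \<le> vec_norm2 v"
  and vec_norm2_power2: "(vec_norm2 v)\<^sup>2 = v \<bullet> v"
proof -
  have "0 \<le> v \<bullet> v" by (simp add: scalar_prod_def sum_nonneg)
  then show "0 \<le> vec_norm2 v" "(vec_norm2 v)\<^sup>2 = v \<bullet> v"
    by (simp_all add: vec_norm2_def)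
qed

lemma vec_norm2_eq_0_imp:
  assumes "v \<in> carrier_vec n" "vec_norm2 v = 0"
  shows "v = 0\<^sub>v n"
proof -
  have "(\<Sum>i = 0..<n. v $ i * v $ i) = 0"
    using assms vec_norm2_power2[of v] by (simp add: scalar_prod_def)
  then have "\<forall>i\<in>{0..<n}. v $ i * v $ i = 0"
    by (subst (asm) sum_nonneg_eq_0_iff) auto
  then show ?thesis using assms(1) by (intro eq_vecI) auto
qed

text \<open>Iterating the decrease bounds \<open>V\<close> along an orbit by
  \<open>\<rho> ^ t\<close> times its initial value. The two-sided comparison with the squared norm
  turns this into the exponential bound \<open>sqrt (C / c) * vec_norm2 x * sqrt \<rho> ^ t\<close>
  on the norm, from which equilibrium, stability and attractivity are all read off.\<close>

lemma geometric_decrease_imp_gas: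
  assumes closed: "\<And>x. x \<in> carrier_vec n \<Longrightarrow> f x \<in> carrier_vec n"
    and lower: "\<And>x. x \<in> carrier_vec n \<Longrightarrow> c * (x \<bullet> x) \<le> V x"
    and upper: "\<And>x. x \<in> carrier_vec n \<Longrightarrow> V x \<le> C * (x \<bullet> x)"
    and decrease: "\<And>x. x \<in> carrier_vec n \<Longrightarrow> V (f x) \<le> \<rho> * V x"
    and "c > 0" "C > 0" "0 \<le> \<rho>" "\<rho> < 1"
  shows "origin_globally_asymptotically_stable n f"
proof -
  define L where "L = sqrt (C / c)"
  have "L > 0" using assms by (simp add: L_def)
  have iter: "(f ^^ t) x \<in> carrier_vec n \<and> V ((f ^^ t) x) \<le> \<rho> ^ t * V x"
    if x: "x \<in> carrier_vec n" for x t
  proof (induction t)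
    case (Suc t)
    have "V ((f ^^ Suc t) x) \<le> \<rho> * V ((f ^^ t) x)" using decrease Suc by simp
    also have "\<dots> \<le> \<rho> * (\<rho> ^ t * V x)" using Suc \<open>0 \<le> \<rho>\<close> by (intro mult_left_mono) auto
    finally show ?case using closed Suc by simp
  qed (use x in simp)
  have bound: "vec_norm2 ((f ^^ t) x) \<le> L * vec_norm2 x * sqrt \<rho> ^ t"
    if x: "x \<in> carrier_vec n" for x t
  proof (rule power2_le_imp_le)
    have "c * (vec_norm2 ((f ^^ t) x))\<^sup>2 \<le> \<rho> ^ t * V x"
      using iter[OF x, of t] lower[of "(f ^^ t) x"] by (simp add: vec_norm2_power2)
    also have "\<dots> \<le> \<rho> ^ t * (C * (vec_norm2 x)\<^sup>2)"
      using upper[OF x] \<open>0 \<le> \<rho>\<close> by (intro mult_left_mono) (auto simp: vec_norm2_power2)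
    finally have "(vec_norm2 ((f ^^ t) x))\<^sup>2 \<le> C / c * (vec_norm2 x)\<^sup>2 * \<rho> ^ t"
      using \<open>c > 0\<close> by (simp add: field_simps)
    moreover have "(sqrt \<rho> ^ t)\<^sup>2 = \<rho> ^ t"
      using \<open>0 \<le> \<rho>\<close> by (simp add: power_mult[symmetric] mult.commute[of t] power_mult)
    ultimately show "(vec_norm2 ((f ^^ t) x))\<^sup>2 \<le> (L * vec_norm2 x * sqrt \<rho> ^ t)\<^sup>2"
      using \<open>c > 0\<close> \<open>C > 0\<close> by (simp add: L_def power_mult_distrib)
    show "0 \<le> L * vec_norm2 x * sqrt \<rho> ^ t"
      using \<open>L > 0\<close> \<open>0 \<le> \<rho>\<close> vec_norm2_nonneg by simp
  qed
  \<comment> \<open>The exponential bound at the origin with \<open>t = 1\<close> forces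
    \<open>f\<close> to fix the origin.\<close>
  have "vec_norm2 (f (0\<^sub>v n)) \<le> 0"
    using bound[of "0\<^sub>v n" 1] by (simp add: vec_norm2_def)
  then have "vec_norm2 (f (0\<^sub>v n)) = 0"
    using vec_norm2_nonneg by (rule order_antisym)
  then have "f (0\<^sub>v n) = 0\<^sub>v n" using closed by (intro vec_norm2_eq_0_imp) auto
  moreover have "origin_lyapunov_stable n f"
    unfolding origin_lyapunov_stable_def
  proof (intro allI impI)
    fix \<epsilon> :: real assume "\<epsilon> > 0"
    show "\<exists>\<delta>>0. \<forall>x0\<in>carrier_vec n. vec_norm2 x0 < \<delta> \<longrightarrow> (\<forall>t. vec_norm2 ((f ^^ t) x0) < \<epsilon>)"
    proof (intro exI[of _ "\<epsilon> / L"] conjI ballI impI allI)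
      fix x t assume x: "x \<in> carrier_vec n" "vec_norm2 x < \<epsilon> / L"
      have "vec_norm2 ((f ^^ t) x) \<le> L * vec_norm2 x * sqrt \<rho> ^ t" by (rule bound[OF x(1)])
      also have "\<dots> \<le> L * vec_norm2 x"
        using \<open>L > 0\<close> \<open>0 \<le> \<rho>\<close> \<open>\<rho> < 1\<close> vec_norm2_nonneg
        by (intro mult_left_le power_le_one) auto
      also have "\<dots> < \<epsilon>" using x(2) \<open>L > 0\<close> by (simp add: field_simps)
      finally show "vec_norm2 ((f ^^ t) x) < \<epsilon>" .
    qed (use \<open>L > 0\<close> \<open>\<epsilon> > 0\<close> in simp)
  qed
  moreover have "(\<lambda>t. vec_norm2 ((f ^^ t) x)) \<longlonglongrightarrow> 0" if x: "x \<in> carrier_vec n" for x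
  proof (rule tendsto_sandwich[OF _ _ tendsto_const])
    have "(\<lambda>t. sqrt \<rho> ^ t) \<longlonglongrightarrow> 0" using \<open>0 \<le> \<rho>\<close> \<open>\<rho> < 1\<close> by (intro LIMSEQ_realpow_zero) auto
    then show "(\<lambda>t. L * vec_norm2 x * sqrt \<rho> ^ t) \<longlonglongrightarrow> 0" by (rule tendsto_mult_right_zero)
  qed (use bound[OF x] vec_norm2_nonneg in auto)
  ultimately show ?thesis
    by (simp add: origin_globally_asymptotically_stable_def origin_equilibrium_def
        origin_globally_attractive_def)
qed

section \<open>Quadratic forms and positive definite matrices\<close>

lemma quadratic_form_bounded:
  fixes R :: "real mat"
  assumes R: "R \<in> carrier_mat n n"
  shows "\<exists>C>0. \<forall>v\<in>carrier_vec n. v \<bullet> (R *\<^sub>v v) \<le> C * (v \<bullet> v)"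
proof -
  \<comment> \<open>The sum of the absolute entries already bounds the form; the extra 1 keeps
    \<open>C\<close> positive when \<open>R\<close> is zero.\<close>
  define C where "C = 1 + (\<Sum>i<n. \<Sum>j<n. \<bar>R $$ (i, j)\<bar>)"
  have "v \<bullet> (R *\<^sub>v v) \<le> C * (v \<bullet> v)" if v: "v \<in> carrier_vec n" for v
  proof -
    have vv: "v \<bullet> v = (\<Sum>i<n. (v $ i)\<^sup>2)"
      using v by (auto simp: scalar_prod_def power2_eq_square atLeast0LessThan)
    then have "0 \<le> v \<bullet> v" by (simp add: sum_nonneg)
    \<comment> \<open>By the arithmetic-geometric mean inequality, the product of two coordinates is
      at most the mean of their squares in absolute value, and each square is at most
      \<open>v \<bullet> v\<close>.\<close>
    have entry: "v $ i * (R $$ (i, j) * v $ j) \<le> \<bar>R $$ (i, j)\<bar> * (v \<bullet> v)"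
      if "i < n" "j < n" for i j
    proof -
      have "(v $ i)\<^sup>2 \<le> v \<bullet> v" "(v $ j)\<^sup>2 \<le> v \<bullet> v"
        unfolding vv using that by (auto intro!: member_le_sum[where f = "\<lambda>i. (v $ i)\<^sup>2"])
      moreover have "2 * (\<bar>v $ i\<bar> * \<bar>v $ j\<bar>) \<le> (v $ i)\<^sup>2 + (v $ j)\<^sup>2"
        using sum_squares_bound[of "\<bar>v $ i\<bar>" "\<bar>v $ j\<bar>"] by (simp add: mult.assoc)
      ultimately have "\<bar>v $ i\<bar> * \<bar>v $ j\<bar> \<le> v \<bullet> v" by linarith
      then have "\<bar>R $$ (i, j)\<bar> * (\<bar>v $ i\<bar> * \<bar>v $ j\<bar>) \<le> \<bar>R $$ (i, j)\<bar> * (v \<bullet> v)"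
        by (intro mult_left_mono) auto
      moreover have "v $ i * (R $$ (i, j) * v $ j) \<le> \<bar>v $ i * (R $$ (i, j) * v $ j)\<bar>"
        by (rule abs_ge_self)
      ultimately show ?thesis by (simp add: abs_mult mult.left_commute)
    qed
    have "v \<bullet> (R *\<^sub>v v) = (\<Sum>i<n. \<Sum>j<n. v $ i * (R $$ (i, j) * v $ j))"
      using v R by (auto simp: scalar_prod_def sum_distrib_left atLeast0LessThan)
    also have "\<dots> \<le> (\<Sum>i<n. \<Sum>j<n. \<bar>R $$ (i, j)\<bar> * (v \<bullet> v))"
      using entry by (intro sum_mono) auto
    also have "\<dots> = (C - 1) * (v \<bullet> v)" by (simp add: C_def sum_distrib_right)
    also have "\<dots> \<le> C * (v \<bullet> v)" using \<open>0 \<le> v \<bullet> v\<close> by (intro mult_right_mono) auto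
    finally show ?thesis .
  qed
  moreover have "C > 0" unfolding C_def by (intro add_pos_nonneg sum_nonneg) auto
  ultimately show ?thesis by blast
qed

lemma sym_mats_scalar_prod_commute:
  assumes "P \<in> sym_mats n" "v \<in> carrier_vec n" "w \<in> carrier_vec n"
  shows "w \<bullet> (P *\<^sub>v v) = v \<bullet> (P *\<^sub>v w)"
proof -
  have P: "P \<in> carrier_mat n n" "transpose_mat P = P" using assms(1) by (auto simp: sym_mats_def)
  have "w \<bullet> (P *\<^sub>v v) = (P *\<^sub>v w) \<bullet> v"
    using transpose_vec_mult_scalar[OF P(1) assms(2,3)] P(2) by simp
  also have "\<dots> = v \<bullet> (P *\<^sub>v w)" using P assms by (intro comm_scalar_prod) auto
  finally show ?thesis .
qed

lemma pos_defD:
  assumes "pos_def P" "P \<in> carrier_mat n n"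
  shows "P \<in> sym_mats n"
    and "v \<in> carrier_vec n \<Longrightarrow> v \<noteq> 0\<^sub>v n \<Longrightarrow> 0 < v \<bullet> (P *\<^sub>v v)"
    and "v \<in> carrier_vec n \<Longrightarrow> 0 \<le> v \<bullet> (P *\<^sub>v v)"
proof -
  show "P \<in> sym_mats n" using assms by (auto simp: pos_def_def)
  show pos: "0 < v \<bullet> (P *\<^sub>v v)" if "v \<in> carrier_vec n" "v \<noteq> 0\<^sub>v n"
    using assms that by (auto simp: pos_def_def)
  show "0 \<le> v \<bullet> (P *\<^sub>v v)" if "v \<in> carrier_vec n"
    using pos[OF that] that assms(2) by (cases "v = 0\<^sub>v n") auto
qed

text \<open>The coercivity bound below uses this inequality to compare the form of \<open>P\<close>
  with that of its inverse.\<close>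

lemma pos_def_cauchy_schwarz:
  assumes P: "pos_def P" "P \<in> carrier_mat n n"
    and v: "v \<in> carrier_vec n" and w: "w \<in> carrier_vec n"
  shows "(v \<bullet> (P *\<^sub>v w))\<^sup>2 \<le> (v \<bullet> (P *\<^sub>v v)) * (w \<bullet> (P *\<^sub>v w))"
proof (cases "w = 0\<^sub>v n")
  case True
  have "P *\<^sub>v 0\<^sub>v n = 0\<^sub>v n" using P(2) by (intro eq_vecI) auto
  then show ?thesis using True v by simp
next
  case False
  define s t where "s = w \<bullet> (P *\<^sub>v w)" and "t = v \<bullet> (P *\<^sub>v w)"
  have "s > 0" using pos_defD(2)[OF P w False] by (simp add: s_def)
  have wv: "w \<bullet> (P *\<^sub>v v) = t"
    using sym_mats_scalar_prod_commute[OF pos_defD(1)[OF P] v w] by (simp add: t_def)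
  have Pv: "P *\<^sub>v v \<in> carrier_vec n" "P *\<^sub>v w \<in> carrier_vec n" using P v w by auto
  \<comment> \<open>This is \<open>s\<close> times the component of \<open>v\<close> that is
    \<open>P\<close>-orthogonal to \<open>w\<close>; the scaling by \<open>s\<close> avoids a
    division.\<close>
  let ?z = "s \<cdot>\<^sub>v v - t \<cdot>\<^sub>v w"
  have "P *\<^sub>v ?z = s \<cdot>\<^sub>v (P *\<^sub>v v) - t \<cdot>\<^sub>v (P *\<^sub>v w)"
    using P v w by (simp add: mult_minus_distrib_mat_vec[of _ n n] mult_mat_vec[of _ n n])
  then have "?z \<bullet> (P *\<^sub>v ?z) = s * (s * (v \<bullet> (P *\<^sub>v v)) - t\<^sup>2)"
    using v w Pv wv
    by (simp add: minus_scalar_prod_distrib[of _ n] scalar_prod_minus_distrib[of _ n]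
        flip: s_def t_def) (simp add: algebra_simps power2_eq_square)
  moreover have "0 \<le> ?z \<bullet> (P *\<^sub>v ?z)" using v w by (intro pos_defD(3)[OF P]) auto
  ultimately have "0 \<le> s * (v \<bullet> (P *\<^sub>v v)) - t\<^sup>2"
    using \<open>s > 0\<close> by (simp add: zero_le_mult_iff)
  then show ?thesis by (simp add: s_def t_def mult.commute)
qed

text \<open>A form that is positive off zero has trivial kernel, hence nonzero determinant.\<close>

lemma pos_def_inverse:
  assumes P: "pos_def P" "P \<in> carrier_mat n n"
  obtains R where "R \<in> carrier_mat n n" "P * R = 1\<^sub>m n" "R * P = 1\<^sub>m n"
proof -
  have "v = 0\<^sub>v n" if "v \<in> carrier_vec n" "P *\<^sub>v v = 0\<^sub>v n" for v
    using pos_defD(2)[OF P that(1)] that by auto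
  then have "det P \<noteq> 0" using det_0_iff_vec_prod_zero[OF P(2)] by auto
  \<comment> \<open>The value \<open>()\<close> merely instantiates the record extension of the
    matrix ring, whose units are the invertible matrices.\<close>
  from det_non_zero_imp_unit[OF P(2) this, of "()"]
  have "mat_inverse P \<noteq> None" using mat_inverse(1)[OF P(2), of "()"] by auto
  then show ?thesis using mat_inverse(2)[OF P(2)] that by auto
qed

text \<open>Neither compactness nor eigenvalues enter. Cauchy-Schwarz for \<open>v\<close> and
  \<open>R *\<^sub>v v\<close>, with \<open>R\<close> the inverse of \<open>P\<close>, bounds the
  square of \<open>v \<bullet> v\<close> by the product of the forms of \<open>P\<close> and
  \<open>R\<close> at \<open>v\<close>. The latter is at most \<open>C * (v \<bullet> v)\<close>,
  and cancelling \<open>v \<bullet> v\<close> leaves the constant \<open>1 / C\<close>.\<close>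

lemma pos_def_coercive:
  assumes P: "pos_def P" "P \<in> carrier_mat n n"
  shows "\<exists>c>0. \<forall>v\<in>carrier_vec n. c * (v \<bullet> v) \<le> v \<bullet> (P *\<^sub>v v)"
proof -
  obtain R where R: "R \<in> carrier_mat n n" "P * R = 1\<^sub>m n" using pos_def_inverse[OF P] .
  obtain C where "C > 0" and C: "\<And>v. v \<in> carrier_vec n \<Longrightarrow> v \<bullet> (R *\<^sub>v v) \<le> C * (v \<bullet> v)"
    using quadratic_form_bounded[OF R(1)] by blast
  have "1 / C * (v \<bullet> v) \<le> v \<bullet> (P *\<^sub>v v)" if v: "v \<in> carrier_vec n" for v
  proof (cases "v \<bullet> v = 0")
    case True
    then show ?thesis using pos_defD(3)[OF P v] by simp
  next
    case False
    then have "v \<bullet> v > 0" by (metis vec_norm2_power2 zero_less_power2 power_zero_numeral)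
    have Rv: "R *\<^sub>v v \<in> carrier_vec n" using R v by auto
    have PR: "P *\<^sub>v (R *\<^sub>v v) = v"
      using P R v by (simp flip: assoc_mult_mat_vec)
    have "(R *\<^sub>v v) \<bullet> v = v \<bullet> (R *\<^sub>v v)" using v Rv by (intro comm_scalar_prod)
    then have "(v \<bullet> v)\<^sup>2 \<le> (v \<bullet> (P *\<^sub>v v)) * (v \<bullet> (R *\<^sub>v v))"
      using pos_def_cauchy_schwarz[OF P v Rv] by (simp add: PR)
    also have "\<dots> \<le> (v \<bullet> (P *\<^sub>v v)) * (C * (v \<bullet> v))"
      using C[OF v] pos_defD(3)[OF P v] by (rule mult_left_mono)
    finally have "(v \<bullet> v) * (v \<bullet> v) \<le> (C * (v \<bullet> (P *\<^sub>v v))) * (v \<bullet> v)"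
      by (simp add: power2_eq_square ac_simps)
    then have "v \<bullet> v \<le> C * (v \<bullet> (P *\<^sub>v v))" using \<open>v \<bullet> v > 0\<close> by simp
    then show ?thesis using \<open>C > 0\<close> by (simp add: field_simps)
  qed
  then show ?thesis using \<open>C > 0\<close> by (intro exI[of _ "1 / C"]) auto
qed

section \<open>Lyapunov decrease from the symmetric block matrix\<close>

lemma symmetric_block_quadratic_form:
  fixes P W :: "real mat"
  assumes P: "P \<in> carrier_mat n n" and W: "W \<in> carrier_mat n n"
    and a: "a \<in> carrier_vec n" and b: "b \<in> carrier_vec n"
  shows "(a @\<^sub>v b) \<bullet> (four_block_mat P (transpose_mat W) W P *\<^sub>v (a @\<^sub>v b))
       = a \<bullet> (P *\<^sub>v a) + 2 * (b \<bullet> (W *\<^sub>v a)) + b \<bullet> (P *\<^sub>v b)"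
proof -
  have "a \<bullet> (transpose_mat W *\<^sub>v b) = b \<bullet> (W *\<^sub>v a)"
    using transpose_vec_mult_scalar[OF W a b] W a b
    by (subst comm_scalar_prod[of _ n]) auto
  moreover have "(a @\<^sub>v b) \<bullet> (four_block_mat P (transpose_mat W) W P *\<^sub>v (a @\<^sub>v b))
      = a \<bullet> (P *\<^sub>v a + transpose_mat W *\<^sub>v b) + b \<bullet> (W *\<^sub>v a + P *\<^sub>v b)"
    using P W a b
    by (subst four_block_mat_mult_vec[of _ n n _ n _ n]) (auto intro!: scalar_prod_append[of _ n _ n])
  ultimately show ?thesis
    using P W a b by (simp add: scalar_prod_add_distrib[of _ n])
qed

text \<open>Evaluate the block form at \<open>v @\<^sub>v 0\<^sub>v n\<close>. This is where the
  invertibility of \<open>P1\<close>, assumed only symmetric, comes from.\<close>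

lemma pos_def_symmetric_block_imp_pos_def:
  assumes P: "P \<in> sym_mats n" and W: "W \<in> carrier_mat n n"
    and H: "pos_def (four_block_mat P (transpose_mat W) W P)"
  shows "pos_def P"
  unfolding pos_def_def
proof (intro conjI ballI impI)
  have Pc: "P \<in> carrier_mat n n" using P by (simp add: sym_mats_def)
  then show "P \<in> sym_mats (dim_row P)" using P by simp
  have Hc: "four_block_mat P (transpose_mat W) W P \<in> carrier_mat (n + n) (n + n)"
    using Pc by (rule four_block_carrier_mat) (rule Pc)
  fix v :: "real vec" assume v: "v \<in> carrier_vec (dim_row P)" "v \<noteq> 0\<^sub>v (dim_row P)"
  then have vn: "v \<in> carrier_vec n" "v \<noteq> 0\<^sub>v n" using Pc by auto
  have "0\<^sub>v (n + n) = 0\<^sub>v n @\<^sub>v (0\<^sub>v n :: real vec)" by (intro eq_vecI) auto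
  then have "v @\<^sub>v 0\<^sub>v n \<noteq> 0\<^sub>v (n + n)"
    using vn append_vec_eq[OF vn(1) zero_carrier_vec] by metis
  then have "0 < (v @\<^sub>v 0\<^sub>v n) \<bullet> (four_block_mat P (transpose_mat W) W P *\<^sub>v (v @\<^sub>v 0\<^sub>v n))"
    using vn by (intro pos_defD(2)[OF H Hc]) auto
  moreover have "W *\<^sub>v v \<in> carrier_vec n" "P *\<^sub>v 0\<^sub>v n \<in> carrier_vec n" using W Pc vn by auto
  ultimately show "0 < v \<bullet> (P *\<^sub>v v)"
    using symmetric_block_quadratic_form[OF Pc W vn(1) zero_carrier_vec] by simp
qed

text \<open>Mere positivity of the block form says only that the form of \<open>R\<close> drops at
  each nonzero state. Its coercivity makes the drop a fixed fraction of the current value, which is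
  the uniform rate that geometric decrease asks for.\<close>

lemma pos_def_symmetric_block_gas:
  assumes P: "P \<in> sym_mats n" and W: "W \<in> carrier_mat n n"
    and H: "pos_def (four_block_mat P (transpose_mat W) W P)"
    and R: "R \<in> carrier_mat n n" and PR: "P * R = 1\<^sub>m n"
    and f: "\<And>x. x \<in> carrier_vec n \<Longrightarrow> f x = (W * R) *\<^sub>v x"
  shows "origin_globally_asymptotically_stable n f"
proof -
  have Pc: "P \<in> carrier_mat n n" using P by (simp add: sym_mats_def)
  have pd: "pos_def P" by (rule pos_def_symmetric_block_imp_pos_def[OF P W H])
  have Hc: "four_block_mat P (transpose_mat W) W P \<in> carrier_mat (n + n) (n + n)"
    using Pc by (rule four_block_carrier_mat) (rule Pc)
  have Rx: "R *\<^sub>v x \<in> carrier_vec n" "P *\<^sub>v (R *\<^sub>v x) = x" if "x \<in> carrier_vec n" for x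
    using Pc R PR that by (simp_all flip: assoc_mult_mat_vec)
  define V where "V x = x \<bullet> (R *\<^sub>v x)" for x
  \<comment> \<open>In the coordinate \<open>R *\<^sub>v x\<close>, \<open>V\<close> is the form of
    \<open>P\<close>, so the lower bound and the decrease can be derived from \<open>P\<close> and
    the block matrix.\<close>
  have V_eq: "V x = (R *\<^sub>v x) \<bullet> (P *\<^sub>v (R *\<^sub>v x))" if x: "x \<in> carrier_vec n" for x
    unfolding V_def Rx(2)[OF x] using x Rx(1)[OF x] by (rule comm_scalar_prod)
  have fc: "f x \<in> carrier_vec n" if "x \<in> carrier_vec n" for x
    using f[OF that] W R that by simp
  have fW: "f x = W *\<^sub>v (R *\<^sub>v x)" if "x \<in> carrier_vec n" for x
    using f[OF that] W R that by simp
  obtain c where "c > 0" and c: "\<And>v. v \<in> carrier_vec (n + n) \<Longrightarrow>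
      c * (v \<bullet> v) \<le> v \<bullet> (four_block_mat P (transpose_mat W) W P *\<^sub>v v)"
    using pos_def_coercive[OF H Hc] by blast
  obtain p where "p > 0" and p: "\<And>v. v \<in> carrier_vec n \<Longrightarrow> p * (v \<bullet> v) \<le> v \<bullet> (P *\<^sub>v v)"
    using pos_def_coercive[OF pd Pc] by blast
  obtain C where "C > 0" and C: "\<And>v. v \<in> carrier_vec n \<Longrightarrow> v \<bullet> (P *\<^sub>v v) \<le> C * (v \<bullet> v)"
    using quadratic_form_bounded[OF Pc] by blast
  obtain D where "D > 0" and D: "\<And>v. v \<in> carrier_vec n \<Longrightarrow> v \<bullet> (R *\<^sub>v v) \<le> D * (v \<bullet> v)"
    using quadratic_form_bounded[OF R] by blast
  \<comment> \<open>This form at \<open>v\<close> is the squared norm of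
    \<open>P *\<^sub>v v\<close>. At \<open>R *\<^sub>v x\<close> it equals
    \<open>x \<bullet> x\<close>, so \<open>E\<close> converts the bound by \<open>p\<close> in the
    coordinate \<open>R *\<^sub>v x\<close> into one in \<open>x\<close>.\<close>
  obtain E where "E > 0" and E: "\<And>v. v \<in> carrier_vec n \<Longrightarrow>
      v \<bullet> ((transpose_mat P * P) *\<^sub>v v) \<le> E * (v \<bullet> v)"
    using quadratic_form_bounded[of "transpose_mat P * P" n] Pc by auto
  have lower: "p / E * (x \<bullet> x) \<le> V x" if x: "x \<in> carrier_vec n" for x
  proof -
    let ?y = "R *\<^sub>v x"
    have "?y \<bullet> ((transpose_mat P * P) *\<^sub>v ?y) = x \<bullet> x"
    proof -
      have "?y \<bullet> ((transpose_mat P * P) *\<^sub>v ?y) = ?y \<bullet> (transpose_mat P *\<^sub>v x)"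
        using Pc Rx[OF x] by (simp add: assoc_mult_mat_vec[of _ n n _ n])
      also have "\<dots> = (transpose_mat P *\<^sub>v x) \<bullet> ?y"
        using Pc x Rx[OF x] by (intro comm_scalar_prod[of _ n]) auto
      also have "\<dots> = x \<bullet> x" using transpose_vec_mult_scalar[OF Pc Rx(1)[OF x] x] Rx[OF x] by simp
      finally show ?thesis .
    qed
    then have "x \<bullet> x \<le> E * (?y \<bullet> ?y)" using E[OF Rx(1)[OF x]] by simp
    then have "p / E * (x \<bullet> x) \<le> p / E * (E * (?y \<bullet> ?y))"
      using \<open>p > 0\<close> \<open>E > 0\<close> by (intro mult_left_mono) auto
    also have "\<dots> = p * (?y \<bullet> ?y)" using \<open>E > 0\<close> by simp
    also have "\<dots> \<le> V x" using p[OF Rx(1)[OF x]] V_eq[OF x] by simp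
    finally show ?thesis .
  qed
  \<comment> \<open>\<open>C + c\<close> instead of \<open>C\<close> keeps the contraction rate nonnegative.\<close>
  have decrease: "V (f x) \<le> (1 - c / (C + c)) * V x" if x: "x \<in> carrier_vec n" for x
  proof -
    define y z where "y = R *\<^sub>v x" and "z = R *\<^sub>v f x"
    have y: "y \<in> carrier_vec n" and z: "z \<in> carrier_vec n"
      using Rx(1) x fc by (auto simp: y_def z_def)
    have Vx: "V x = y \<bullet> (P *\<^sub>v y)" and Vf: "V (f x) = z \<bullet> (P *\<^sub>v z)"
      using V_eq x fc by (auto simp: y_def z_def)
    \<comment> \<open>Both sides are \<open>f x\<close>. Hence the cross term of the block form at
      \<open>y @\<^sub>v - z\<close> is minus twice the form of \<open>P\<close> at
      \<open>z\<close>; the lower block restores one copy, leaving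
      \<open>V x - V (f x)\<close>.\<close>
    have "W *\<^sub>v y = P *\<^sub>v z" using fW[OF x] Rx(2)[OF fc[OF x]] by (simp add: y_def z_def)
    moreover have "P *\<^sub>v (- z) = - (P *\<^sub>v z)" "P *\<^sub>v z \<in> carrier_vec n"
      using Pc z by auto
    ultimately have "(y @\<^sub>v - z) \<bullet> (four_block_mat P (transpose_mat W) W P *\<^sub>v (y @\<^sub>v - z))
        = V x - V (f x)"
      using z Pc by (subst symmetric_block_quadratic_form[OF Pc W y]) (auto simp: Vx Vf)
    moreover have "(y @\<^sub>v - z) \<bullet> (y @\<^sub>v - z) = y \<bullet> y + z \<bullet> z"
      using y z by (subst scalar_prod_append[of _ n _ n]) auto
    moreover have "0 \<le> z \<bullet> z" by (simp flip: vec_norm2_power2)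
    ultimately have "c * (y \<bullet> y) \<le> V x - V (f x)"
      using c[of "y @\<^sub>v - z"] y z \<open>c > 0\<close> by (simp add: distrib_left)
        (smt (verit) mult_nonneg_nonneg)
    \<comment> \<open>Read backwards, this bounds \<open>y \<bullet> y\<close> below by a multiple
      of \<open>V x\<close>, so that the drop \<open>c * (y \<bullet> y)\<close> is at least the
      fraction \<open>c / (C + c)\<close> of \<open>V x\<close>.\<close>
    moreover have "V x \<le> (C + c) * (y \<bullet> y)"
    proof -
      have "V x \<le> C * (y \<bullet> y)" using C[OF y] Vx by simp
      also have "\<dots> \<le> (C + c) * (y \<bullet> y)"
        using \<open>c > 0\<close> by (intro mult_right_mono) (auto simp flip: vec_norm2_power2)
      finally show ?thesis .
    qed
    then have "c / (C + c) * V x \<le> c / (C + c) * ((C + c) * (y \<bullet> y))"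
      using \<open>c > 0\<close> \<open>C > 0\<close> by (intro mult_left_mono) auto
    ultimately show ?thesis using \<open>c > 0\<close> \<open>C > 0\<close> by (simp add: left_diff_distrib)
  qed
  show ?thesis
  proof (rule geometric_decrease_imp_gas[OF fc lower _ decrease])
    show "V x \<le> D * (x \<bullet> x)" if "x \<in> carrier_vec n" for x using D[OF that] by (simp add: V_def)
  qed (use \<open>c > 0\<close> \<open>C > 0\<close> \<open>D > 0\<close> \<open>p > 0\<close> \<open>E > 0\<close> in auto)
qed

section \<open>The feedback gain and the data matrices\<close>

lemma append_cols_mult_append_vec:
  assumes Y: "Y \<in> carrier_mat k n" and G: "G \<in> carrier_mat k l"
    and a: "a \<in> carrier_vec n" and b: "b \<in> carrier_vec l"
  shows "(Y @\<^sub>c G) *\<^sub>v (a @\<^sub>v b) = Y *\<^sub>v a + G *\<^sub>v b"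
proof -
  have "(Y @\<^sub>c G) *\<^sub>v (a @\<^sub>v b)
      = (Y *\<^sub>v a + G *\<^sub>v b) @\<^sub>v (0\<^sub>m 0 n *\<^sub>v a + 0\<^sub>m 0 l *\<^sub>v b)"
    using assms unfolding append_cols_def by (subst four_block_mat_mult_vec[of _ k n _ l _ 0]) auto
  \<comment> \<open>The bottom blocks have no rows, so the appended tail has dimension 0.\<close>
  also have "\<dots> = Y *\<^sub>v a + G *\<^sub>v b" using assms by (intro eq_vecI) auto
  finally show ?thesis .
qed

lemma append_cols_carrier:
  "Y \<in> carrier_mat k n \<Longrightarrow> G \<in> carrier_mat k l \<Longrightarrow> Y @\<^sub>c G \<in> carrier_mat k (n + l)"
  unfolding append_cols_def using four_block_carrier_mat[of Y k n "0\<^sub>m 0 (dim_col G)" 0 l] by auto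

text \<open>The block-diagonal matrix sends \<open>(R *\<^sub>v x) @\<^sub>v q\<close> to
  \<open>x @\<^sub>v q\<close>, so its inverse undoes this. Its invertibility has to be shown first,
  to give \<open>the (mat_inverse ...)\<close> a meaning.\<close>

lemma feedback_gain_mult_lift:
  assumes P1: "P1 \<in> carrier_mat n n" and R: "R \<in> carrier_mat n n"
    and PR: "P1 * R = 1\<^sub>m n" "R * P1 = 1\<^sub>m n"
    and U0: "U0 \<in> carrier_mat m T" and Y1: "Y1 \<in> carrier_mat T n"
    and G2: "G2 \<in> carrier_mat T (S - n)"
    and x: "x \<in> carrier_vec n" and q: "q \<in> carrier_vec (S - n)"
  shows "feedback_gain n S U0 Y1 G2 P1 *\<^sub>v (x @\<^sub>v q)
      = U0 *\<^sub>v (Y1 *\<^sub>v (R *\<^sub>v x) + G2 *\<^sub>v q)"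
proof -
  let ?l = "S - n"
  define D where "D = four_block_mat P1 (0\<^sub>m n ?l) (0\<^sub>m ?l n) (1\<^sub>m ?l)"
  define E where "E = four_block_mat R (0\<^sub>m n ?l) (0\<^sub>m ?l n) (1\<^sub>m ?l)"
  have D: "D \<in> carrier_mat (n + ?l) (n + ?l)" and E: "E \<in> carrier_mat (n + ?l) (n + ?l)"
    unfolding D_def E_def using P1 R by auto
  have DE: "D * E = 1\<^sub>m (n + ?l)"
    unfolding D_def E_def using P1 R PR
    by (subst mult_four_block_mat[of _ n n _ ?l _ ?l]) auto
  \<comment> \<open>A one-sided inverse of a square matrix is two-sided, so \<open>D\<close> is a
    unit and \<open>mat_inverse D\<close> is not \<open>None\<close>.\<close>
  have ED: "E * D = 1\<^sub>m (n + ?l)" using mat_mult_left_right_inverse[OF D E DE] .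
  have "mat_inverse D \<noteq> None"
    using mat_inverse(1)[OF D, of "()"] D E DE ED by (auto simp: Units_def ring_mat_def)
  then obtain F where F: "mat_inverse D = Some F" by auto
  then have FD: "F * D = 1\<^sub>m (n + ?l)"
    and Fc: "F \<in> carrier_mat (n + ?l) (n + ?l)"
    using mat_inverse(2)[OF D] by auto
  have K: "feedback_gain n S U0 Y1 G2 P1 = U0 * (Y1 @\<^sub>c G2) * F"
    by (simp add: feedback_gain_def F flip: D_def)
  have YG: "Y1 @\<^sub>c G2 \<in> carrier_mat T (n + ?l)" using Y1 G2 by (rule append_cols_carrier)
  have w: "(R *\<^sub>v x) @\<^sub>v q \<in> carrier_vec (n + ?l)" using R x q by auto
  have Rx: "R *\<^sub>v x \<in> carrier_vec n" "P1 *\<^sub>v (R *\<^sub>v x) = x"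
    using P1 R PR x by (simp_all flip: assoc_mult_mat_vec)
  \<comment> \<open>The computed inverse \<open>F\<close> is never identified with \<open>E\<close>:
    applying \<open>F\<close> to this equation and using \<open>F * D = 1\<^sub>m (n + ?l)\<close>
    evaluates it at the one vector that matters.\<close>
  have "D *\<^sub>v ((R *\<^sub>v x) @\<^sub>v q) = x @\<^sub>v q"
    unfolding D_def using P1 Rx q by (subst mult_mat_vec_split[of _ n]) auto
  then have "F *\<^sub>v (x @\<^sub>v q) = (F * D) *\<^sub>v ((R *\<^sub>v x) @\<^sub>v q)"
    using assoc_mult_mat_vec[OF Fc D w] by simp
  then have Fx: "F *\<^sub>v (x @\<^sub>v q) = (R *\<^sub>v x) @\<^sub>v q" using FD w by simp
  have "feedback_gain n S U0 Y1 G2 P1 *\<^sub>v (x @\<^sub>v q) = U0 *\<^sub>v ((Y1 @\<^sub>c G2) *\<^sub>v (F *\<^sub>v (x @\<^sub>v q)))"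
    unfolding K using U0 YG Fc x q
    by (subst assoc_mult_mat_vec[of _ m "n + ?l" _ "n + ?l"])
       (auto intro!: assoc_mult_mat_vec mult_carrier_mat)
  also have "\<dots> = U0 *\<^sub>v (Y1 *\<^sub>v (R *\<^sub>v x) + G2 *\<^sub>v q)"
    unfolding Fx using Y1 G2 Rx q by (subst append_cols_mult_append_vec) auto
  finally show "feedback_gain n S U0 Y1 G2 P1 *\<^sub>v (x @\<^sub>v q)
      = U0 *\<^sub>v (Y1 *\<^sub>v (R *\<^sub>v x) + G2 *\<^sub>v q)" .
qed

text \<open>Column \<open>k\<close> of this matrix identity is the system equation at sample
  \<open>k\<close>.\<close>

lemma data_equation:
  assumes nS: "n \<le> S" and A: "A \<in> carrier_mat n S" and B: "B \<in> carrier_mat n m"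
    and Q: "Q \<in> carrier_vec n \<rightarrow> carrier_vec (S - n)"
    and x: "\<And>k. k \<le> T \<Longrightarrow> x k \<in> carrier_vec n"
    and u: "\<And>k. k < T \<Longrightarrow> u k \<in> carrier_vec m"
    and step: "\<And>k. k < T \<Longrightarrow> x (k + 1) = plant A B Q (x k) (u k)"
  shows "shifted_state_data n T x = A * lifted_data S T Q x + B * input_data m T u"
proof (rule mat_col_eqI)
  have Z: "lifted_data S T Q x \<in> carrier_mat S T"
    unfolding lifted_data_def by (rule carrier_matI) simp_all
  have U: "input_data m T u \<in> carrier_mat m T"
    unfolding input_data_def by (rule carrier_matI) simp_all
  show "dim_row (shifted_state_data n T x) = dim_row (A * lifted_data S T Q x + B * input_data m T u)"
    "dim_col (shifted_state_data n T x) = dim_col (A * lifted_data S T Q x + B * input_data m T u)"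
    using B U by (auto simp: shifted_state_data_def)
  fix k assume "k < dim_col (A * lifted_data S T Q x + B * input_data m T u)"
  then have k: "k < T" using U by simp
  have lift: "lift_state Q (x k) \<in> carrier_vec S"
  proof -
    have "x k \<in> carrier_vec n" using x[of k] k by simp
    then have "lift_state Q (x k) \<in> carrier_vec (n + (S - n))"
      unfolding lift_state_def using Q by auto
    then show ?thesis using nS by simp
  qed
  \<comment> \<open>The list starts at 1, so its entry at index \<open>k\<close> is
    \<open>x (k + 1)\<close>, still a valid state because \<open>k + 1 \<le> T\<close>. Removing
    \<open>upt_Suc\<close> keeps \<open>[1..<T + 1]\<close> in one piece for indexing.\<close>
  have "col (shifted_state_data n T x) k = x (k + 1)"
    unfolding shifted_state_data_def using k x[of "k + 1"]
    by (subst col_mat_of_cols) (auto simp del: upt_Suc)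
  moreover have "col (lifted_data S T Q x) k = lift_state Q (x k)"
    unfolding lifted_data_def using k lift by (subst col_mat_of_cols) auto
  moreover have "col (input_data m T u) k = u k"
    unfolding input_data_def using k u by (subst col_mat_of_cols) auto
  moreover have "col (A * lifted_data S T Q x + B * input_data m T u) k
      = A *\<^sub>v col (lifted_data S T Q x) k + B *\<^sub>v col (input_data m T u) k"
    using A B Z U k by (subst col_add) auto
  ultimately show "col (shifted_state_data n T x) k
      = col (A * lifted_data S T Q x + B * input_data m T u) k"
    using step[OF k] by (simp add: plant_def)
qed

theorem theorem1:
  fixes n m S T :: nat
    and A B P1 Y1 G2 U0 X1 Z0 K :: "real mat"
    and Q :: "real vec \<Rightarrow> real vec"
    and x u :: "nat \<Rightarrow> real vec"
  assumes "n > 0" and "m > 0" and "S > 0" and "T > 0" and "S \<ge> n"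
    and "A \<in> carrier_mat n S" and "B \<in> carrier_mat n m"
    and "Q \<in> carrier_vec n \<rightarrow> carrier_vec (S - n)"
    and "\<And>k. k \<le> T \<Longrightarrow> x k \<in> carrier_vec n"
    and "\<And>k. k < T \<Longrightarrow> u k \<in> carrier_vec m"
    and "\<And>k. k < T \<Longrightarrow> x (k + 1) = plant A B Q (x k) (u k)"
    and "U0 = input_data m T u"
    and "X1 = shifted_state_data n T x"
    and "Z0 = lifted_data S T Q x"
    and "P1 \<in> sym_mats n" and "Y1 \<in> carrier_mat T n" and "G2 \<in> carrier_mat T (S - n)"
    and "Z0 * Y1 = P1 @\<^sub>r 0\<^sub>m (S - n) n"
    and "pos_def (four_block_mat P1 (transpose_mat (X1 * Y1)) (X1 * Y1) P1)"
    and "Z0 * G2 = 0\<^sub>m n (S - n) @\<^sub>r 1\<^sub>m (S - n)"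
    and "X1 * G2 = 0\<^sub>m n (S - n)"
    and "K = feedback_gain n S U0 Y1 G2 P1"
  shows "linear_dynamics n (closed_loop A B Q K)
       \<and> origin_globally_asymptotically_stable n (closed_loop A B Q K)"
proof -
  note nS = \<open>S \<ge> n\<close> and A = \<open>A \<in> carrier_mat n S\<close> and B = \<open>B \<in> carrier_mat n m\<close>
    and Q = \<open>Q \<in> carrier_vec n \<rightarrow> carrier_vec (S - n)\<close>
    and P1 = \<open>P1 \<in> sym_mats n\<close> and Y1 = \<open>Y1 \<in> carrier_mat T n\<close>
    and G2 = \<open>G2 \<in> carrier_mat T (S - n)\<close>
    and ZY = \<open>Z0 * Y1 = P1 @\<^sub>r 0\<^sub>m (S - n) n\<close>
    and H = \<open>pos_def (four_block_mat P1 (transpose_mat (X1 * Y1)) (X1 * Y1) P1)\<close>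
    and ZG = \<open>Z0 * G2 = 0\<^sub>m n (S - n) @\<^sub>r 1\<^sub>m (S - n)\<close>
    and XG = \<open>X1 * G2 = 0\<^sub>m n (S - n)\<close>
    and K = \<open>K = feedback_gain n S U0 Y1 G2 P1\<close>
  have X1: "X1 \<in> carrier_mat n T" and Z0: "Z0 \<in> carrier_mat S T" and U0: "U0 \<in> carrier_mat m T"
    unfolding assms(12-14) shifted_state_data_def lifted_data_def input_data_def
    by (rule carrier_matI; simp)+
  have data: "X1 = A * Z0 + B * U0"
    unfolding assms(12-14) by (rule data_equation[OF nS A B Q]) (fact assms(9-11))+
  define W where "W = X1 * Y1"
  have W: "W \<in> carrier_mat n n" using X1 Y1 by (simp add: W_def)
  have P1c: "P1 \<in> carrier_mat n n" using P1 by (simp add: sym_mats_def)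
  obtain R where R: "R \<in> carrier_mat n n" and PR: "P1 * R = 1\<^sub>m n" "R * P1 = 1\<^sub>m n"
    using pos_def_inverse[OF pos_def_symmetric_block_imp_pos_def[OF P1 W] P1c] H
    by (auto simp: W_def)
  have closed: "closed_loop A B Q K x = (W * R) *\<^sub>v x" if x: "x \<in> carrier_vec n" for x
  proof -
    have q: "Q x \<in> carrier_vec (S - n)" using Q x by auto
    have Rx: "R *\<^sub>v x \<in> carrier_vec n" "P1 *\<^sub>v (R *\<^sub>v x) = x"
      using P1c R PR x by (simp_all flip: assoc_mult_mat_vec)
    \<comment> \<open>The coefficients of \<open>lift_state Q x\<close> in the columns of
      \<open>Z0\<close>. The same combination of recorded inputs is the feedback, and that of
      recorded successors is the next state.\<close>
    define g where "g = Y1 *\<^sub>v (R *\<^sub>v x) + G2 *\<^sub>v Q x"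
    have g: "g \<in> carrier_vec T" using Y1 G2 Rx q by (auto simp: g_def)
    \<comment> \<open>Kept general in \<open>N\<close> to serve for both \<open>Z0\<close> and
      \<open>X1\<close>.\<close>
    have mult_g: "N *\<^sub>v g = (N * Y1) *\<^sub>v (R *\<^sub>v x) + (N * G2) *\<^sub>v Q x"
      if "N \<in> carrier_mat r T" for N r
      using that Y1 G2 Rx q
      by (simp add: g_def mult_add_distrib_mat_vec[of _ r T] assoc_mult_mat_vec[of _ r T])
    \<comment> \<open>The \<open>Y1\<close> part of \<open>g\<close> reproduces the linear entries
      of the lifted state, the \<open>G2\<close> part the nonlinear ones.\<close>
    have "(Z0 * Y1) *\<^sub>v (R *\<^sub>v x) = x @\<^sub>v 0\<^sub>v (S - n)"
      unfolding ZY using P1c Rx by (subst mat_mult_append[of _ n n _ "S - n"]) auto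
    moreover have "(Z0 * G2) *\<^sub>v Q x = 0\<^sub>v n @\<^sub>v Q x"
      unfolding ZG using q by (subst mat_mult_append[of _ n "S - n" _ "S - n"]) auto
    ultimately have lift: "lift_state Q x = Z0 *\<^sub>v g"
      using mult_g[OF Z0] x q by (simp add: lift_state_def append_vec_add[of _ n _ _ "S - n"])
    have "K *\<^sub>v lift_state Q x = U0 *\<^sub>v g"
      unfolding K lift_state_def g_def
      by (rule feedback_gain_mult_lift[OF P1c R PR U0 Y1 G2 x q])
    then have "closed_loop A B Q K x = A *\<^sub>v (Z0 *\<^sub>v g) + B *\<^sub>v (U0 *\<^sub>v g)"
      unfolding closed_loop_def plant_def by (simp add: lift)
    \<comment> \<open>Here the unknown \<open>A\<close> and \<open>B\<close> disappear in favour of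
      the measured \<open>X1\<close>.\<close>
    also have "\<dots> = X1 *\<^sub>v g"
      unfolding data using A B Z0 U0 g
      by (simp add: add_mult_distrib_mat_vec[of _ n T] assoc_mult_mat_vec[of _ n _ _ T])
    also have "\<dots> = W *\<^sub>v (R *\<^sub>v x)"
    proof -
      have "0\<^sub>m n (S - n) *\<^sub>v Q x = 0\<^sub>v n" using q by (intro eq_vecI) auto
      moreover have "W *\<^sub>v (R *\<^sub>v x) \<in> carrier_vec n" using W Rx by simp
      ultimately show ?thesis using mult_g[OF X1] XG by (simp flip: W_def)
    qed
    also have "\<dots> = (W * R) *\<^sub>v x" using W R x by simp
    finally show ?thesis .
  qed
  have "linear_dynamics n (closed_loop A B Q K)"
    unfolding linear_dynamics_def using closed W R by (intro bexI[of _ "W * R"]) auto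
  then show ?thesis
    using pos_def_symmetric_block_gas[OF P1 W _ R PR(1) closed] H by (simp add: W_def)
qed

end
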